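(* For every graph $G$ on $n$ vertices and $m$ edges, with $n$ sufficiently large, and for every $\varepsilon\in(0,1/2)$, $G$ has a subgraph that is globally rigid in $\mathbb{R}$ on at least $$\frac{m}{n}\,2^{-\frac{\log n}{\log(1/\varepsilon)}}-3\,\frac{\log n}{\varepsilon}$$ vertices.
   Context: A graph $H=(V,E)$ is globally rigid in $\mathbb{R}$ if for every pair of injective maps $f,g:V\to\mathbb{R}$ satisfying $|f(x)-f(y)|=|g(x)-g(y)|$ for every edge $xy\in E$, we also have $|f(x)-f(y)|=|g(x)-g(y)|$ for every pair $x,y\in V$. Here $\log$ is the natural logarithm. *)

theory Defs
  imports Complex_Main
begin

definition simple_graph :: "'a set \<Rightarrow> 'a set set \<Rightarrow> bool" where
  "simple_graph V E \<longleftrightarrow> finite V \<and> (\<forall>e\<in>E. e \<subseteq> V \<and> card e = 2)"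

text \<open>Subgraphs need not be induced.\<close>

definition is_subgraph :: "'a set \<Rightarrow> 'a set set \<Rightarrow> 'a set \<Rightarrow> 'a set set \<Rightarrow> bool" where
  "is_subgraph V' E' V E \<longleftrightarrow> simple_graph V' E' \<and> V' \<subseteq> V \<and> E' \<subseteq> E"

text \<open>A map from \<open>V\<close> to the reals is given by a total function; its values outside \<open>V\<close> play no role,
  since every edge of a graph lies in \<open>V\<close>.\<close>

definition globally_rigid_line :: "'a set \<Rightarrow> 'a set set \<Rightarrow> bool" where
  "globally_rigid_line V E \<longleftrightarrow>
     (\<forall>f g :: 'a \<Rightarrow> real.
        inj_on f V \<longrightarrow> inj_on g V \<longrightarrow>
        (\<forall>x y. {x, y} \<in> E \<longrightarrow> \<bar>f x - f y\<bar> = \<bar>g x - g y\<bar>) \<longrightarrow>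
        (\<forall>x\<in>V. \<forall>y\<in>V. \<bar>f x - f y\<bar> = \<bar>g x - g y\<bar>))"

end

theory Submission
  imports Defs
begin

text \<open>Two realisations \<open>f\<close>, \<open>g\<close> of a graph on the line with equal edge lengths turn into the planar
  map \<open>(f - g, f + g)\<close>: it is injective and every edge becomes horizontal or vertical, while the
  distances all agree as soon as the image lies on one horizontal or vertical line. So a graph that
  is not globally rigid splits along the lines of a grid. Let all globally rigid subgraphs have at
  most \<open>k\<close> vertices, and let \<open>\<gamma> = log 2 / log (1/\<epsilon>)\<close>, so that \<open>\<epsilon>\<^sup>\<gamma> = 1/2\<close>. Then
  \<open>m \<le> n\<^sup>1\<^sup>+\<^sup>\<gamma> (k + 3 log n / \<epsilon>)\<close> by induction on \<open>n\<close>. If all lines have at most \<open>\<epsilon>n\<close> vertices, each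
  vertex lies on two of them, and this loss of a factor 2 is recovered from the factor \<open>n\<^sup>\<gamma>\<close>. If a
  line \<open>W\<close> has more than \<open>\<epsilon>n\<close> vertices, each vertex outside \<open>W\<close> has at most one neighbour in \<open>W\<close>, and
  the at most \<open>n - |W|\<close> edges lost on splitting off \<open>W\<close> are paid for by the logarithmic term.\<close>

section \<open>Induced subgraphs\<close>

definition induced_edges :: "'a set set \<Rightarrow> 'a set \<Rightarrow> 'a set set" where
  "induced_edges E W = {e \<in> E. e \<subseteq> W}"

lemma simple_graph_finite_edges:
  assumes "simple_graph V E"
  shows "finite E"
proof -
  have "E \<subseteq> Pow V" "finite V" using assms by (auto simp: simple_graph_def)
  then show ?thesis by (meson finite_Pow_iff finite_subset)
qed

lemma simple_graph_induced:
  assumes "simple_graph V E" "W \<subseteq> V"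
  shows "simple_graph W (induced_edges E W)"
  using assms by (auto simp: simple_graph_def induced_edges_def intro: finite_subset)

lemma is_subgraph_induced:
  assumes "is_subgraph V' E' W (induced_edges E W)" "W \<subseteq> V"
  shows "is_subgraph V' E' V E"
  using assms by (auto simp: is_subgraph_def induced_edges_def)

section \<open>Graphs drawn along the lines of a grid\<close>

lemma not_globally_rigid_grid:
  assumes "\<not> globally_rigid_line V E"
  obtains a b :: "'a \<Rightarrow> real"
  where "inj_on (\<lambda>v. (a v, b v)) V"
    and "\<forall>x y. {x, y} \<in> E \<longrightarrow> a x = a y \<or> b x = b y"
    and "\<forall>s. {v \<in> V. a v = s} \<noteq> V \<and> {v \<in> V. b v = s} \<noteq> V"
proof -
  from assms obtain f g :: "'a \<Rightarrow> real" and p q where inj: "inj_on f V" "inj_on g V"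
    and edge: "\<And>x y. {x, y} \<in> E \<Longrightarrow> \<bar>f x - f y\<bar> = \<bar>g x - g y\<bar>"
    and pq: "p \<in> V" "q \<in> V" "\<bar>f p - f q\<bar> \<noteq> \<bar>g p - g q\<bar>"
    unfolding globally_rigid_line_def by blast
  \<comment> \<open>Two reals have equal absolute value only if they are equal or opposite, so on
    each edge \<open>f - g\<close> or \<open>f + g\<close> takes the same value at both ends.
    Conversely, if one of these maps were constant on \<open>V\<close>, the distances between
    \<open>p\<close> and \<open>q\<close> would agree.\<close>
  show thesis
  proof (rule that[of "\<lambda>v. f v - g v" "\<lambda>v. f v + g v"])
    show "inj_on (\<lambda>v. (f v - g v, f v + g v)) V"
    proof (rule inj_onI)
      fix x y assume "x \<in> V" "y \<in> V" "(f x - g x, f x + g x) = (f y - g y, f y + g y)"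
      moreover from this have "f x = f y" unfolding prod.inject by linarith
      ultimately show "x = y" using inj by (auto dest: inj_onD)
    qed
    show "\<forall>x y. {x, y} \<in> E \<longrightarrow> f x - g x = f y - g y \<or> f x + g x = f y + g y"
    proof (intro allI impI)
      fix x y assume "{x, y} \<in> E"
      then show "f x - g x = f y - g y \<or> f x + g x = f y + g y"
        using edge[of x y] by linarith
    qed
    show "\<forall>s. {v \<in> V. f v - g v = s} \<noteq> V \<and> {v \<in> V. f v + g v = s} \<noteq> V"
    proof (intro allI conjI notI)
      fix s assume "{v \<in> V. f v - g v = s} = V"
      then have "f p - g p = s" "f q - g q = s" using pq by auto
      then show False using pq(3) by linarith
    next
      fix s assume "{v \<in> V. f v + g v = s} = V"
      then have "f p + g p = s" "f q + g q = s" using pq by auto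
      then show False using pq(3) by linarith
    qed
  qed
qed

text \<open>On an edge leaving \<open>W\<close> the coordinate \<open>a\<close> changes, so the edge
  runs along a line of \<open>b\<close>. By injectivity such a line meets \<open>W\<close> in at
  most one vertex, hence each vertex outside \<open>W\<close> sends at most one edge into it. The
  assumptions on \<open>a\<close> and \<open>b\<close> are symmetric, so the lemma also serves with
  the two exchanged.\<close>

lemma card_edges_split_line:
  fixes a b :: "'a \<Rightarrow> real"
  assumes G: "simple_graph V E"
    and inj: "\<And>x y. x \<in> V \<Longrightarrow> y \<in> V \<Longrightarrow> a x = a y \<Longrightarrow> b x = b y \<Longrightarrow> x = y"
    and edge: "\<And>x y. {x, y} \<in> E \<Longrightarrow> a x = a y \<or> b x = b y"
    and W: "W = {v \<in> V. a v = s}"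
  shows "card E \<le> card (induced_edges E W) + card (induced_edges E (V - W)) + card (V - W)"
proof -
  \<comment> \<open>\<open>h v\<close> is the only candidate for an edge from \<open>v\<close> into
    \<open>W\<close>. If no such \<open>w\<close> exists, \<open>THE\<close> gives an arbitrary
    value; this is harmless, as only a set covering the crossing edges is wanted.\<close>
  define h where "h v = {v, THE w. w \<in> W \<and> b w = b v}" for v
  have fin: "finite V" "finite E" using G simple_graph_finite_edges by (auto simp: simple_graph_def)
  have cross: "{x, y} \<in> h ` (V - W)" if "{x, y} \<in> E" "x \<in> V - W" "y \<in> W" for x y
  proof -
    have "b y = b x" using edge[OF that(1)] that W by auto
    then have "(THE w. w \<in> W \<and> b w = b x) = y"
      using that(3) inj W by (intro the_equality) auto
    then show ?thesis using that(2) by (auto simp: h_def)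
  qed
  have "E \<subseteq> (induced_edges E W \<union> induced_edges E (V - W)) \<union> h ` (V - W)"
  proof
    fix e assume e: "e \<in> E"
    then have eV: "e \<subseteq> V" and c2: "card e = 2" using G by (auto simp: simple_graph_def)
    obtain x y where xy: "e = {x, y}" using c2 by (auto simp: card_2_iff)
    have "x \<in> V" "y \<in> V" using eV xy by auto
    then consider "x \<in> W" "y \<in> W" | "x \<in> V - W" "y \<in> V - W" | "x \<in> V - W" "y \<in> W"
      | "y \<in> V - W" "x \<in> W" by blast
    then show "e \<in> (induced_edges E W \<union> induced_edges E (V - W)) \<union> h ` (V - W)"
    proof cases
      case 3 then show ?thesis using cross[of x y] e xy by auto
    next
      case 4 then show ?thesis using cross[of y x] e xy by (auto simp: insert_commute)
    qed (use e xy in \<open>auto simp: induced_edges_def\<close>)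
  qed
  then have "card E \<le> card ((induced_edges E W \<union> induced_edges E (V - W)) \<union> h ` (V - W))"
    using fin by (intro card_mono) (auto simp: induced_edges_def)
  also have "\<dots> \<le> card (induced_edges E W) + card (induced_edges E (V - W)) + card (h ` (V - W))"
    by (meson add_le_mono1 card_Un_le order_trans)
  also have "card (h ` (V - W)) \<le> card (V - W)" using fin by (intro card_image_le) auto
  finally show ?thesis by simp
qed

text \<open>An edge on which \<open>a\<close> or \<open>b\<close> agrees lies inside the
  corresponding line through its ends, so the edge sets of the lines cover \<open>E\<close>.\<close>

lemma card_edges_le_sum_lines:
  fixes a b :: "'a \<Rightarrow> real"
  assumes G: "simple_graph V E"
    and edge: "\<And>x y. {x, y} \<in> E \<Longrightarrow> a x = a y \<or> b x = b y"
  shows "card E \<le> (\<Sum>s\<in>a ` V. card (induced_edges E {v \<in> V. a v = s}))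
                 + (\<Sum>s\<in>b ` V. card (induced_edges E {v \<in> V. b v = s}))"
proof -
  have fin: "finite V" "finite E" using G simple_graph_finite_edges by (auto simp: simple_graph_def)
  let ?A = "\<Union>s\<in>a ` V. induced_edges E {v \<in> V. a v = s}"
  let ?B = "\<Union>s\<in>b ` V. induced_edges E {v \<in> V. b v = s}"
  have "E \<subseteq> ?A \<union> ?B"
  proof
    fix e assume e: "e \<in> E"
    then have eV: "e \<subseteq> V" and c2: "card e = 2" using G by (auto simp: simple_graph_def)
    obtain x y where xy: "e = {x, y}" using c2 by (auto simp: card_2_iff)
    show "e \<in> ?A \<union> ?B" using edge[of x y] e eV xy by (auto simp: induced_edges_def)
  qed
  then have "card E \<le> card (?A \<union> ?B)"
    using fin by (intro card_mono) (auto simp: induced_edges_def)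
  also have "\<dots> \<le> card ?A + card ?B" by (rule card_Un_le)
  also have "\<dots> \<le> (\<Sum>s\<in>a ` V. card (induced_edges E {v \<in> V. a v = s}))
                 + (\<Sum>s\<in>b ` V. card (induced_edges E {v \<in> V. b v = s}))"
    using fin by (intro add_mono card_UN_le) auto
  finally show ?thesis .
qed

section \<open>Counting by fibres and estimates for logarithms\<close>

lemma sum_card_fibres:
  assumes "finite V"
  shows "(\<Sum>s\<in>a ` V. card {v \<in> V. a v = s}) = card V"
  using sum.image_gen[OF assms, of "\<lambda>_. 1::nat" a] by simp

text \<open>This is \<open>ln t \<le> t - 1\<close> at \<open>t = x / y\<close>. Multiplied by
  \<open>3 / \<epsilon>\<close>, the gain becomes a constant that pays for the edges cut when a
  large line is removed.\<close>

lemma ln_add_fraction_le: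
  fixes x y \<epsilon> :: real
  assumes "0 < x" "0 < y" "x \<le> (1 - \<epsilon>) * y"
  shows "ln x + \<epsilon> \<le> ln y"
proof -
  have "ln x - ln y = ln (x / y)" using assms by (simp add: ln_div)
  also have "\<dots> \<le> x / y - 1" using assms by (intro ln_le_minus_one) auto
  also have "x / y \<le> 1 - \<epsilon>" using assms by (simp add: field_simps)
  finally show ?thesis by simp
qed

lemma half_powr_ln_ratio:
  fixes \<epsilon> :: real
  assumes "0 < \<epsilon>" "\<epsilon> < 1"
  shows "\<epsilon> powr (ln 2 / ln (1 / \<epsilon>)) = 1 / 2"
proof -
  have "ln \<epsilon> < 0" using assms by simp
  moreover have "ln (1 / \<epsilon>) = - ln \<epsilon>" using assms by (simp add: ln_div)
  ultimately have "ln 2 / ln (1 / \<epsilon>) * ln \<epsilon> = - ln 2" by simp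
  then have "\<epsilon> powr (ln 2 / ln (1 / \<epsilon>)) = exp (- ln 2)" using assms unfolding powr_def by simp
  then show ?thesis by (simp add: exp_minus)
qed

section \<open>The edge bound, by induction on the number of vertices\<close>

lemma card_edges_le_of_rigid_bound:
  fixes V :: "'a set" and \<epsilon> :: real
  assumes eps: "0 < \<epsilon>" "\<epsilon> < 1 / 2"
    and G: "simple_graph V E"
    and k: "\<And>V' E'. is_subgraph V' E' V E \<Longrightarrow> globally_rigid_line V' E' \<Longrightarrow> card V' \<le> k"
  shows "real (card E) \<le> real (card V) *
    (real (card V) powr (ln 2 / ln (1 / \<epsilon>)) * (real k + 3 * ln (real (card V)) / \<epsilon>))"
  using G k
proof (induction "card V" arbitrary: V E rule: less_induct)
  case less
  define \<gamma> where "\<gamma> = ln 2 / ln (1 / \<epsilon>)"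
  \<comment> \<open>\<open>h n\<close> is the allowance of edges per vertex. It grows with
    \<open>n\<close> for positive \<open>n\<close>, and charging per vertex lets the bounds for
    disjoint vertex sets be added.\<close>
  define h where "h n = real n powr \<gamma> * (real k + 3 * ln (real n) / \<epsilon>)" for n :: nat
  define n where "n = card V"
  have gpos: "0 < \<gamma>" using eps by (simp add: \<gamma>_def)
  have G: "simple_graph V E" and finV: "finite V"
    using less.prems(1) by (auto simp: simple_graph_def)
  \<comment> \<open>Globally rigid subgraphs of an induced subgraph are subgraphs of the whole
    graph, so the bound \<open>k\<close>, and with it \<open>h\<close>, stays the same for all
    \<open>W\<close>.\<close>
  have IH: "real (card (induced_edges E W)) \<le> real (card W) * h (card W)" if "W \<subset> V" for W
  proof -
    have "card W < card V" using that finV by (rule psubset_card_mono[rotated])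
    moreover have "simple_graph W (induced_edges E W)" using G that by (simp add: simple_graph_induced)
    moreover have "card V' \<le> k"
      if "is_subgraph V' E' W (induced_edges E W)" "globally_rigid_line V' E'" for V' E'
      using less.prems(2) that is_subgraph_induced \<open>W \<subset> V\<close> by blast
    ultimately show ?thesis unfolding h_def \<gamma>_def by (rule less.hyps)
  qed
  have "real (card E) \<le> real n * h n"
  proof (cases "V = {}")
    case True
    then have "E = {}" using G by (fastforce simp: simple_graph_def)
    then show ?thesis using True by (simp add: n_def)
  next
    case False
    then have n1: "1 \<le> n" using finV by (simp add: n_def Suc_leI card_gt_0_iff)
    have hnn: "0 \<le> real k + 3 * ln (real n) / \<epsilon>" using n1 eps by simp
    show ?thesis
    proof (cases "globally_rigid_line V E")
      case True
      \<comment> \<open>The whole graph is now one of the rigid subgraphs bounded by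
        \<open>k\<close>, and the crude estimate of \<open>n * n\<close> edges suffices because
        \<open>n \<le> k \<le> h n\<close>.\<close>
      then have nk: "n \<le> k" using less.prems(2)[of V E] G by (simp add: n_def is_subgraph_def)
      have pw: "1 \<le> real n powr \<gamma>" using n1 gpos by (simp add: ge_one_powr_ge_zero)
      have "E \<subseteq> (\<lambda>(x, y). {x, y}) ` (V \<times> V)"
      proof
        fix e assume "e \<in> E"
        then have "e \<subseteq> V" "card e = 2" using G by (auto simp: simple_graph_def)
        then show "e \<in> (\<lambda>(x, y). {x, y}) ` (V \<times> V)" by (auto simp: card_2_iff image_iff)
      qed
      then have "card E \<le> card (V \<times> V)" using finV by (meson finite_SigmaI surj_card_le)
      then have "real (card E) \<le> real n * real n"
        by (simp add: card_cartesian_product n_def flip: of_nat_mult)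
      also have "\<dots> \<le> real n * h n"
      proof (rule mult_left_mono)
        have "real n \<le> real k + 3 * ln (real n) / \<epsilon>" using nk n1 eps
          by (intro add_increasing2) auto
        also have "\<dots> \<le> h n" unfolding h_def using mult_right_mono[OF pw hnn] by simp
        finally show "real n \<le> h n" .
      qed simp
      finally show ?thesis .
    next
      case False
      obtain a b :: "'a \<Rightarrow> real"
        where ab: "inj_on (\<lambda>v. (a v, b v)) V"
          "\<forall>x y. {x, y} \<in> E \<longrightarrow> a x = a y \<or> b x = b y"
          "\<forall>s. {v \<in> V. a v = s} \<noteq> V \<and> {v \<in> V. b v = s} \<noteq> V"
        by (rule not_globally_rigid_grid[OF False])
      have inj: "\<And>x y. x \<in> V \<Longrightarrow> y \<in> V \<Longrightarrow> a x = a y \<Longrightarrow> b x = b y \<Longrightarrow> x = y"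
        using ab(1) by (auto dest: inj_onD)
      have edge: "\<And>x y. {x, y} \<in> E \<Longrightarrow> a x = a y \<or> b x = b y" using ab(2) by blast
      have ne: "\<And>s. {v \<in> V. a v = s} \<noteq> V" "\<And>s. {v \<in> V. b v = s} \<noteq> V" using ab(3) by blast+
      \<comment> \<open>The vertices of \<open>W\<close> are charged \<open>h n\<close> each. At
        most \<open>(1 - \<epsilon>) * n\<close> vertices remain, so their allowance drops by at
        least \<open>3 * n powr \<gamma>\<close>, hence by at least 1; this unit per vertex of
        \<open>V - W\<close> pays for the crossing edges.\<close>
      have large: ?thesis
        if split: "card E \<le> card (induced_edges E W) + card (induced_edges E (V - W)) + card (V - W)"
          and W: "W \<subset> V" and big: "\<epsilon> * real n < real (card W)" for W
      proof -
        have cW: "real (card (V - W)) = real n - real (card W)" and "card W \<le> n"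
          using W finV by (auto simp: n_def card_Diff_subset finite_subset card_mono of_nat_diff)
        have "0 < \<epsilon> * real n" using eps n1 by simp
        then have W0: "0 < card W" using big by linarith
        have V0: "0 < card (V - W)" using W finV by (auto simp: card_gt_0_iff)
        have "h (card W) \<le> h n"
          unfolding h_def using W0 \<open>card W \<le> n\<close> eps gpos
          by (intro mult_mono powr_mono2 add_mono divide_right_mono) auto
        then have e1: "real (card (induced_edges E W)) \<le> real (card W) * h n"
          using IH[OF W] by (meson mult_left_mono of_nat_0_le_iff order_trans)
        have "real (card (V - W)) \<le> (1 - \<epsilon>) * real n" using cW big by (simp add: algebra_simps)
        then have "ln (real (card (V - W))) + \<epsilon> \<le> ln (real n)"
          using V0 n1 by (intro ln_add_fraction_le) auto
        then have "3 * ln (real (card (V - W))) / \<epsilon> \<le> 3 * ln (real n) / \<epsilon> - 3"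
          using eps by (simp add: field_simps)
        then have "h (card (V - W)) \<le> real n powr \<gamma> * (real k + (3 * ln (real n) / \<epsilon> - 3))"
          unfolding h_def using V0 cW eps gpos
          by (intro mult_mono powr_mono2 add_mono) auto
        also have "\<dots> = h n - 3 * real n powr \<gamma>" by (simp add: h_def algebra_simps)
        also have "\<dots> \<le> h n - 1"
          using ge_one_powr_ge_zero[of "real n" \<gamma>] n1 gpos by simp
        finally have hm: "h (card (V - W)) \<le> h n - 1" .
        have "W \<noteq> {}" using W0 by auto
        then have "V - W \<subset> V" using W by blast
        then have e2: "real (card (induced_edges E (V - W))) \<le> real (card (V - W)) * (h n - 1)"
          using IH hm by (meson mult_left_mono of_nat_0_le_iff order_trans)
        have "real (card E) \<le> real (card (induced_edges E W))
            + real (card (induced_edges E (V - W))) + real (card (V - W))"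
          using split by (simp flip: of_nat_add)
        also have "\<dots> \<le> real (card W) * h n + real (card (V - W)) * (h n - 1) + real (card (V - W))"
          using e1 e2 by simp
        also have "\<dots> = real n * h n" by (simp add: cW algebra_simps)
        finally show ?thesis .
      qed
      show ?thesis
      proof (cases "\<exists>s. \<epsilon> * real n < real (card {v \<in> V. a v = s})
          \<or> \<epsilon> * real n < real (card {v \<in> V. b v = s})")
        case True
        then obtain s where "\<epsilon> * real n < real (card {v \<in> V. a v = s})
          \<or> \<epsilon> * real n < real (card {v \<in> V. b v = s})" by blast
        then show ?thesis
        proof
          assume "\<epsilon> * real n < real (card {v \<in> V. a v = s})"
          then show ?thesis using ne(1)[of s]
            by (intro large[of "{v \<in> V. a v = s}"] card_edges_split_line[OF G inj edge]) auto
        next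
          assume "\<epsilon> * real n < real (card {v \<in> V. b v = s})"
          moreover have "b x = b y \<or> a x = a y" if "{x, y} \<in> E" for x y using edge[OF that] by blast
          ultimately show ?thesis using ne(2)[of s] inj
            by (intro large[of "{v \<in> V. b v = s}"] card_edges_split_line[of V E b a, OF G]) auto
        qed
      next
        case False
        \<comment> \<open>Each vertex lies on exactly one line of the family \<open>c\<close>, so
          halving the allowance on every line gives half of \<open>n * h n\<close>. The families of
          \<open>a\<close> and \<open>b\<close> together then give the full bound.\<close>
        have small: "(\<Sum>s\<in>c ` V. real (card (induced_edges E {v \<in> V. c v = s}))) \<le> real n * (h n / 2)"
          if le: "\<And>s. real (card {v \<in> V. c v = s}) \<le> \<epsilon> * real n"
            and pr: "\<And>s. {v \<in> V. c v = s} \<noteq> V" for c :: "'a \<Rightarrow> real"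
        proof -
          have "real (card (induced_edges E {v \<in> V. c v = s}))
              \<le> real (card {v \<in> V. c v = s}) * (h n / 2)" if "s \<in> c ` V" for s
          proof -
            let ?W = "{v \<in> V. c v = s}"
            have "?W \<noteq> {}" using that by auto
            then have W0: "0 < card ?W" using finV by (simp add: card_gt_0_iff)
            have "card ?W \<le> n" unfolding n_def using finV by (intro card_mono) auto
            \<comment> \<open>The halving comes from the power alone: it shrinks by the factor
              \<open>\<epsilon> powr \<gamma>\<close>, while the logarithm is only bounded by
              \<open>ln n\<close>.\<close>
            have "h (card ?W) \<le> (\<epsilon> * real n) powr \<gamma> * (real k + 3 * ln (real n) / \<epsilon>)"
              unfolding h_def using W0 \<open>card ?W \<le> n\<close> eps gpos le[of s]
              by (intro mult_mono powr_mono2 add_mono divide_right_mono) auto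
            also have "\<dots> = \<epsilon> powr \<gamma> * h n" using eps by (simp add: h_def powr_mult)
            also have "\<dots> = h n / 2" using half_powr_ln_ratio[of \<epsilon>] eps by (simp add: \<gamma>_def)
            finally have "h (card ?W) \<le> h n / 2" .
            moreover have "?W \<subset> V" using pr[of s] by auto
            ultimately show ?thesis
              using IH[of ?W] by (meson mult_left_mono of_nat_0_le_iff order_trans)
          qed
          then have "(\<Sum>s\<in>c ` V. real (card (induced_edges E {v \<in> V. c v = s})))
              \<le> (\<Sum>s\<in>c ` V. real (card {v \<in> V. c v = s}) * (h n / 2))" by (rule sum_mono)
          also have "\<dots> = real (\<Sum>s\<in>c ` V. card {v \<in> V. c v = s}) * (h n / 2)"
            by (simp add: sum_distrib_right)
          finally show ?thesis using sum_card_fibres[OF finV, of c] by (simp add: n_def)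
        qed
        have "real (card E) \<le> (\<Sum>s\<in>a ` V. real (card (induced_edges E {v \<in> V. a v = s})))
            + (\<Sum>s\<in>b ` V. real (card (induced_edges E {v \<in> V. b v = s})))"
          using card_edges_le_sum_lines[OF G edge] by (simp flip: of_nat_sum of_nat_add)
        also have "\<dots> \<le> real n * (h n / 2) + real n * (h n / 2)"
          using False ne by (intro add_mono small) (auto simp: not_less)
        finally show ?thesis by simp
      qed
    qed
  qed
  then show ?case by (simp add: h_def n_def \<gamma>_def)
qed

section \<open>From the edge bound to a large rigid subgraph\<close>

theorem theorem10p1:
  "\<exists>N::nat. \<forall>n m :: nat. \<forall>(V :: 'a set) (E :: 'a set set). \<forall>\<epsilon>::real.
     n \<ge> N \<longrightarrow> simple_graph V E \<longrightarrow> card V = n \<longrightarrow> card E = m \<longrightarrow> 0 < \<epsilon> \<longrightarrow> \<epsilon> < 1 / 2 \<longrightarrow>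
     (\<exists>V' E'. is_subgraph V' E' V E \<and> globally_rigid_line V' E' \<and>
        real (card V') \<ge>
          real m / real n * 2 powr (- (ln (real n) / ln (1 / \<epsilon>))) - 3 * (ln (real n) / \<epsilon>))"
\<comment> \<open>The threshold 1 makes \<open>n\<close> and its power positive, so that the edge
  bound can be divided by both.\<close>
proof (intro exI[of _ 1] allI impI)
  fix n m :: nat and V :: "'a set" and E :: "'a set set" and \<epsilon> :: real
  assume n1: "1 \<le> n" and G: "simple_graph V E" and n: "card V = n" and m: "card E = m"
    and eps: "0 < \<epsilon>" "\<epsilon> < 1 / 2"
  \<comment> \<open>\<open>k\<close> will be the largest number of vertices of a globally rigid
    subgraph. It exists because the empty graph is rigid and \<open>n\<close> bounds all
    sizes.\<close>
  define P where "P j \<longleftrightarrow> (\<exists>V' E'. is_subgraph V' E' V E \<and> globally_rigid_line V' E' \<and> card V' = j)"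
    for j
  have "P 0" unfolding P_def
    by (intro exI[of _ "{}"]) (auto simp: is_subgraph_def simple_graph_def globally_rigid_line_def)
  moreover have "\<forall>j. P j \<longrightarrow> j \<le> n"
    using G n by (auto simp: P_def is_subgraph_def simple_graph_def intro: card_mono)
  ultimately obtain k where "P k" and kmax: "\<And>j. P j \<Longrightarrow> j \<le> k"
    by (metis GreatestI_nat Greatest_le_nat)
  then obtain V' E' where V': "is_subgraph V' E' V E" "globally_rigid_line V' E'" "card V' = k"
    by (auto simp: P_def)
  let ?p = "real n powr (ln 2 / ln (1 / \<epsilon>))"
  have "real m \<le> real n * (?p * (real k + 3 * ln (real n) / \<epsilon>))"
    using card_edges_le_of_rigid_bound[OF eps G, of k] kmax n m by (auto simp: P_def)
  moreover have "0 < ?p" using n1 by simp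
  ultimately have "real m / real n / ?p \<le> real k + 3 * ln (real n) / \<epsilon>"
    using n1 by (simp add: field_simps)
  \<comment> \<open>Both sides are the exponential of
    \<open>- ln 2 * ln n / ln (1 / \<epsilon>)\<close>.\<close>
  moreover have "2 powr (- (ln (real n) / ln (1 / \<epsilon>))) = 1 / ?p"
    using n1 by (simp add: powr_def exp_minus field_simps)
  ultimately have "real m / real n * 2 powr (- (ln (real n) / ln (1 / \<epsilon>))) - 3 * (ln (real n) / \<epsilon>)
      \<le> real (card V')" using V'(3) by simp
  then show "\<exists>V' E'. is_subgraph V' E' V E \<and> globally_rigid_line V' E' \<and>
        real (card V') \<ge>
          real m / real n * 2 powr (- (ln (real n) / ln (1 / \<epsilon>))) - 3 * (ln (real n) / \<epsilon>)"
    using V' by blast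
qed

end
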